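(* Let $\omega$ be an aperiodic uniformly recurrent balanced infinite word on the alphabet $\{0,1,2\}$ in which each of the letters $0,1,2$ occurs. Then $\rho^{\mathrm{ab}}_{\omega}(n)=3$ for all $n\ge 1$.
   Context: Infinite words are right-infinite words $\omega=\omega_0\omega_1\omega_2\cdots$. A factor of $\omega$ is a finite block of consecutive letters of $\omega$. For a finite word $u$ and a letter $a$, $|u|_a$ is the number of occurrences of $a$ in $u$. The word $\omega$ is balanced if $\bigl||U|_a-|V|_a\bigr|\le 1$ for every letter $a$ and all factors $U,V$ of $\omega$ of equal length. It is ultimately periodic if there is $p\ge1$ with $\omega_{i+p}=\omega_i$ for all sufficiently large $i$, and aperiodic if it is not ultimately periodic. It is uniformly recurrent if each of its factors occurs in it infinitely often with bounded gaps. Two finite words $u,v$ are Abelian equivalent if $|u|_a=|v|_a$ for all letters $a$; $\rho^{\mathrm{ab}}_{\omega}(n)$ is the number of Abelian equivalence classes of factors of $\omega$ of length $n$. *)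

theory Defs
  imports Main "HOL-Library.Omega_Words_Fun"
begin

text \<open>
  Infinite words are of type \<^typ>\<open>'a word\<close> of \<^theory>\<open>HOL-Library.Omega_Words_Fun\<close>,
  where \<open>w [i \<rightarrow> j]\<close> is the finite block of the letters at positions \<open>i, \<dots>, j - 1\<close>.
\<close>

definition factors :: "'a word \<Rightarrow> 'a list set" where
  "factors w = {w [i \<rightarrow> i + n] | i n. True}"

definition balanced :: "'a word \<Rightarrow> bool" where
  "balanced w \<longleftrightarrow>
     (\<forall>U\<in>factors w. \<forall>V\<in>factors w. length U = length V \<longrightarrow>
        (\<forall>a. \<bar>int (count_list U a) - int (count_list V a)\<bar> \<le> 1))"

definition ultimately_periodic :: "'a word \<Rightarrow> bool" where
  "ultimately_periodic w \<longleftrightarrow> (\<exists>p\<ge>1. \<exists>N. \<forall>i\<ge>N. w (i + p) = w i)"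

definition aperiodic :: "'a word \<Rightarrow> bool" where
  "aperiodic w \<longleftrightarrow> \<not> ultimately_periodic w"

text \<open>
  A factor occurs infinitely often with bounded gaps iff, for some \<open>g\<close>, every position is followed
  by the start of an occurrence at distance at most \<open>g\<close>.
\<close>

definition uniformly_recurrent :: "'a word \<Rightarrow> bool" where
  "uniformly_recurrent w \<longleftrightarrow>
     (\<forall>u\<in>factors w. \<exists>g. \<forall>i. \<exists>j. i \<le> j \<and> j \<le> i + g \<and> w [j \<rightarrow> j + length u] = u)"

definition abelian_equivalent :: "'a list \<Rightarrow> 'a list \<Rightarrow> bool" where
  "abelian_equivalent u v \<longleftrightarrow> (\<forall>a. count_list u a = count_list v a)"

text \<open>
  Being a \<^const>\<open>card\<close>, the complexity is meaningful only when there are finitely many classes of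
  length \<open>n\<close>, which always holds for a word over a finite alphabet.
\<close>

definition abelian_complexity :: "'a word \<Rightarrow> nat \<Rightarrow> nat" where
  "abelian_complexity w n =
     card ({u \<in> factors w. length u = n} // {(u, v). abelian_equivalent u v})"

end

theory Submission
  imports Defs
begin

text \<open>
  Fix a length \<open>n \<ge> 1\<close>. By balance, the number of occurrences of a given letter in a window of
  length \<open>n\<close> takes at most two values, which are consecutive. Suppose that each of the three
  letters does take two values, \<open>m\<close> and \<open>m + 1\<close> with \<open>m\<close> depending on the letter. Subtracting the
  lower values turns the Parikh vectors of the windows into vectors in \<open>{0, 1}\<^sup>3\<close> with constant
  coordinate sum \<open>s\<close>; as no coordinate is constant, \<open>s\<close> is 1 or 2, and all three vectors of that
  sum occur. So there are exactly three Abelian classes.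

  It remains to see that in an aperiodic word no letter \<open>c\<close> has a constant count over the windows
  of length \<open>n\<close> (\<open>ultimately_periodic_if_constant_count\<close>). If it had, the occurrences of \<open>c\<close> would
  be invariant under translation by \<open>n\<close>. Choose one, at \<open>p\<close>, and compare the windows of length \<open>n\<close>
  that start at the positions \<open>p + n j\<close>.
  Either they all contain the same number of occurrences of another letter \<open>a\<close>. Then longer windows
  made of consecutive such blocks have exactly linear counts of \<open>a\<close>, and balance leaves room
  for only finitely many windows of length \<open>n\<close> with any other count
  (\<open>eventually_constant_count\<close>), so that \<open>a\<close>, too, is ultimately \<open>n\<close>-periodic. Or two of them have
  different counts. Adding or removing the letter \<open>c\<close> at one end of these two windows yields two
  windows of length \<open>n + 1\<close>, and two of length \<open>n - 1\<close>, whose Parikh vectors are so far apart that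
  balance determines the counts in any window that is obtained by adding or removing a letter other
  than \<open>c\<close>. This forces the letters other than \<open>c\<close> to be swapped by translation by \<open>n\<close>, and the word
  is \<open>2 n\<close>-periodic.
\<close>

section \<open>Letter counts of windows\<close>

definition occ :: "'a word \<Rightarrow> 'a \<Rightarrow> nat \<Rightarrow> nat \<Rightarrow> nat" where
  "occ w a i n = count_list (w [i \<rightarrow> i + n]) a"

lemma occ_0 [simp]: "occ w a i 0 = 0"
  by (simp add: occ_def subsequence_def)

lemma occ_add: "occ w a i (m + n) = occ w a i m + occ w a (i + m) n"
proof -
  have "[i..<i + (m + n)] = [i..<i + m] @ [i + m..<i + m + n]"
    using upt_add_eq_append[of i "i + m" n] by (simp add: add.assoc)
  then show ?thesis by (simp add: occ_def subsequence_def)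
qed

lemma occ_1: "occ w a i (Suc 0) = of_bool (w i = a)"
  by (simp add: occ_def subsequence_def)

lemma occ_Suc: "occ w a i (Suc n) = occ w a i n + of_bool (w (i + n) = a)"
  using occ_add[of w a i n 1] by (simp add: occ_1)

lemma occ_Suc_left: "occ w a i (Suc n) = of_bool (w i = a) + occ w a (Suc i) n"
  using occ_add[of w a i 1 n] by (simp add: occ_1)

lemma occ_mult: "occ w a i (n * k) = (\<Sum>j<k. occ w a (i + n * j) n)"
proof (induction k)
  case (Suc k)
  then show ?case using occ_add[of w a i "n * k" n] by (simp add: add.commute)
qed simp

lemma occ_sum_three_letters:
  assumes "range w = {a, b, c}" and "a \<noteq> b" "a \<noteq> c" "b \<noteq> c"
  shows "occ w a i n + occ w b i n + occ w c i n = n"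
proof (induction n)
  case (Suc n)
  have "w (i + n) \<in> {a, b, c}" using assms(1) by blast
  then show ?case using Suc assms(2-4) by (auto simp: occ_Suc)
qed simp

lemma balanced_occ_le:
  assumes "balanced w"
  shows "occ w a i n \<le> occ w a j n + 1"
proof -
  have "w [i \<rightarrow> i + n] \<in> factors w" "w [j \<rightarrow> j + n] \<in> factors w"
    unfolding factors_def by blast+
  then have "\<bar>int (occ w a i n) - int (occ w a j n)\<bar> \<le> 1"
    using assms unfolding balanced_def occ_def by simp
  then show ?thesis by linarith
qed

section \<open>Letters with constant counts\<close>

lemma periodic_letter_if_constant_count:
  assumes "\<forall>i\<ge>N. occ w a i n = M" and "i \<ge> N"
  shows "w (i + n) = a \<longleftrightarrow> w i = a"
proof -
  have "occ w a i n = M" "occ w a (Suc i) n = M" using assms by auto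
  then have "(of_bool (w (i + n) = a) :: nat) = of_bool (w i = a)"
    using occ_Suc[of w a i n] occ_Suc_left[of w a i n] by simp
  then show ?thesis by (simp only: of_bool_eq_iff)
qed

text \<open>
  Nonzero deviations from \<open>M\<close> of the counts in blocks of length \<open>n\<close> all have the same sign, by
  balance. A window made of
  blocks of length \<open>n\<close> that contains two deviating blocks would therefore deviate by at least 2 from
  the window of the same length at \<open>p\<close>, whose count is exactly linear. So each residue class modulo
  \<open>n\<close> contains at most one starting position of a deviating block.
\<close>

lemma eventually_constant_count:
  assumes bal: "balanced w" and "n \<ge> 1"
    and block: "\<And>j. occ w a (p + n * j) n = M"
  shows "\<exists>N. \<forall>i\<ge>N. occ w a i n = M"
proof -
  define d where "d i = int (occ w a i n) - int M" for i
  have d_diff: "\<bar>d i - d j\<bar> \<le> 1" for i j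
    using balanced_occ_le[OF bal, of a i n j] balanced_occ_le[OF bal, of a j n i]
    unfolding d_def by linarith
  have d_abs: "\<bar>d i\<bar> \<le> 1" for i
    using d_diff[of i p] block[of 0] by (simp add: d_def)
  have d_sum: "\<bar>\<Sum>j<k. d (i + n * j)\<bar> \<le> 1" for i k
  proof -
    have "(\<Sum>j<k. d (i + n * j)) = int (occ w a i (n * k)) - int (k * M)"
      by (simp add: d_def occ_mult sum_subtractf)
    moreover have "occ w a p (n * k) = k * M"
      by (simp add: occ_mult block)
    ultimately show ?thesis
      using balanced_occ_le[OF bal, of a i "n * k" p] balanced_occ_le[OF bal, of a p "n * k" i]
      by linarith
  qed
  have unique: False if "d i \<noteq> 0" "d (i + n * k) \<noteq> 0" "k \<ge> 1" for i k
  proof -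
    obtain m where k: "k = Suc m" using \<open>k \<ge> 1\<close> by (cases k) auto
    have s: "d i = 1 \<or> d i = -1" using d_abs[of i] that(1) by linarith
    \<comment> \<open>The factor \<open>d i\<close> is a sign, which treats excess and deficit at once.\<close>
    have nonneg: "d i * d l \<ge> 0" for l
      using s d_diff[of i l] by auto
    have last: "d i * d (i + n * k) = 1"
      using s d_diff[of i "i + n * k"] d_abs[of "i + n * k"] that(2) by auto
    have "(\<Sum>j<Suc k. d i * d (i + n * j))
        = d i * d i + (\<Sum>j<m. d i * d (i + n * Suc j)) + d i * d (i + n * k)"
      unfolding k sum.lessThan_Suc[of _ "Suc m"] sum.lessThan_Suc_shift[of _ m] by simp
    also have "\<dots> \<ge> 2"
      using s last sum_nonneg[of "{..<m}" "\<lambda>j. d i * d (i + n * Suc j)"] nonneg by auto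
    finally have "d i * (\<Sum>j<Suc k. d (i + n * j)) \<ge> 2" by (simp only: sum_distrib_left)
    then show False using s d_sum[where i = i and k = "Suc k"] by auto
  qed
  have "inj_on (\<lambda>i. i mod n) {i. d i \<noteq> 0}"
  proof (rule linorder_inj_onI)
    fix i j assume ij: "i < j" "i \<in> {i. d i \<noteq> 0}" "j \<in> {i. d i \<noteq> 0}"
    show "i mod n \<noteq> j mod n"
    proof
      assume "i mod n = j mod n"
      then obtain k where k: "j = i + n * k"
        using ij(1) by (metis mod_eq_nat1E less_imp_le)
      then have "k \<ge> 1" using ij(1) by (cases k) auto
      then show False using unique[of i k] ij k by simp
    qed
  qed auto
  moreover have "finite ((\<lambda>i. i mod n) ` {i. d i \<noteq> 0})"
    by (rule finite_subset[of _ "{..<n}"]) (use \<open>n \<ge> 1\<close> in auto)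
  ultimately have "finite {i. d i \<noteq> 0}" using finite_imageD by blast
  then obtain N where "\<forall>i\<in>{i. d i \<noteq> 0}. i < N"
    using finite_nat_set_iff_bounded by blast
  then have "\<forall>i\<ge>N. occ w a i n = M" by (force simp: d_def)
  then show ?thesis ..
qed

text \<open>
  The windows of length \<open>n\<close> at \<open>P\<close> and \<open>Q\<close> start with \<open>c\<close> and are followed by \<open>c\<close>, and their Parikh
  vectors differ. Hence dropping the first letter or appending the next one changes neither count
  of \<open>a\<close> or \<open>b\<close>, and balance bounds these counts from below in windows of length \<open>n - 1\<close> and from above
  in windows of length \<open>n + 1\<close>. At a position that does not carry \<open>c\<close> these bounds are attained, so
  that \<open>a\<close> occurs exactly once among the positions \<open>q\<close> and \<open>q + n\<close>.
\<close>

lemma other_letters_alternate: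
  assumes bal: "balanced w" and "n \<ge> 1"
    and letters: "range w = {a, b, c}" "a \<noteq> b" "a \<noteq> c" "b \<noteq> c"
    and const: "\<And>i. occ w c i n = K"
    and PQ: "w P = c" "w Q = c" "occ w a P n = Suc (occ w a Q n)"
    and q: "w q \<noteq> c"
  shows "w (q + n) = a \<longleftrightarrow> w q \<noteq> a"
proof -
  note total = occ_sum_three_letters[OF letters]
  obtain m where n: "n = Suc m" using \<open>n \<ge> 1\<close> by (cases n) auto
  define M where "M = occ w a Q n"
  define L where "L = occ w b P n"
  have shift: "w (i + n) = c \<longleftrightarrow> w i = c" for i
    using periodic_letter_if_constant_count[of 0 w c n K i] const by simp
  have aP: "occ w a P n = Suc M" and aQ: "occ w a Q n = M"
    using PQ(3) by (simp_all add: M_def)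
  have bP: "occ w b P n = L" and bQ: "occ w b Q n = Suc L"
    using total[of P n] total[of Q n] aP aQ const[of P] const[of Q] by (simp_all add: L_def)
  have long_a: "occ w a q (Suc n) \<le> Suc M"
    using balanced_occ_le[OF bal, of a q "Suc n" Q] aQ PQ shift[of Q] letters
    by (simp add: occ_Suc)
  have long_b: "occ w b q (Suc n) \<le> Suc L"
    using balanced_occ_le[OF bal, of b q "Suc n" P] bP PQ shift[of P] letters
    by (simp add: occ_Suc)
  have short_a: "occ w a (Suc q) m \<ge> M"
    using balanced_occ_le[OF bal, of a "Suc P" m "Suc q"] aP PQ letters
    by (simp add: occ_Suc_left n)
  have short_b: "occ w b (Suc q) m \<ge> L"
    using balanced_occ_le[OF bal, of b "Suc Q" m "Suc q"] bQ PQ letters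
    by (simp add: occ_Suc_left n)
  have c_short: "occ w c (Suc q) m = K"
    using const[of q] q by (simp add: occ_Suc_left n)
  have c_long: "occ w c q (Suc n) = K"
    using const[of q] q shift[of q] by (simp add: occ_Suc)
  have sum_n: "Suc M + L + K = n"
    using total[of P n] aP bP const[of P] by simp
  have "occ w a (Suc q) m = M"
    using total[of "Suc q" m] c_short short_a short_b sum_n n by linarith
  moreover have "occ w a q (Suc n) = Suc M"
    using total[of q "Suc n"] c_long long_a long_b sum_n by linarith
  moreover have "occ w a q (Suc n)
      = of_bool (w q = a) + occ w a (Suc q) m + of_bool (w (q + n) = a)"
    by (simp add: occ_Suc[of w a q n]) (simp add: n occ_Suc_left)
  ultimately show ?thesis by (cases "w q = a"; cases "w (q + n) = a") auto
qed

lemma ultimately_periodic_if_constant_count: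
  assumes bal: "balanced w" and "n \<ge> 1"
    and letters: "range w = {a, b, c}" "a \<noteq> b" "a \<noteq> c" "b \<noteq> c"
    and const: "\<And>i. occ w c i n = K"
  shows "ultimately_periodic w"
proof -
  have in_letters: "w i \<in> {a, b, c}" for i using letters(1) by blast
  have shift: "w (i + n) = c \<longleftrightarrow> w i = c" for i
    using periodic_letter_if_constant_count[of 0 w c n K i] const by simp
  obtain p where "w p = c" using letters(1) by (metis insertCI rangeE)
  then have p: "w (p + n * j) = c" for j
  proof (induction j)
    case (Suc j)
    then show ?case using shift[of "p + n * j"] by (simp add: algebra_simps)
  qed simp
  show ?thesis
  proof (cases "\<forall>j. occ w a (p + n * j) n = occ w a p n")
    case True
    then obtain N where N: "\<forall>i\<ge>N. occ w a i n = occ w a p n"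
      using eventually_constant_count[OF bal \<open>n \<ge> 1\<close>, of a p "occ w a p n"] by auto
    have "w (i + n) = w i" if "i \<ge> N" for i
      using periodic_letter_if_constant_count[OF N that] shift[of i]
        in_letters[of i] in_letters[of "i + n"] by auto
    then show ?thesis unfolding ultimately_periodic_def using \<open>n \<ge> 1\<close> by blast
  next
    case False
    then obtain j where j: "occ w a (p + n * j) n \<noteq> occ w a p n" by blast
    have "\<exists>P Q. w P = c \<and> w Q = c \<and> occ w a P n = Suc (occ w a Q n)"
    proof (cases "occ w a (p + n * j) n < occ w a p n")
      case True
      then have "occ w a p n = Suc (occ w a (p + n * j) n)"
        using balanced_occ_le[OF bal, of a p n "p + n * j"] by linarith
      then show ?thesis using p[of j] \<open>w p = c\<close> by blast
    next
      case False
      then have "occ w a (p + n * j) n = Suc (occ w a p n)"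
        using j balanced_occ_le[OF bal, of a "p + n * j" n p] by linarith
      then show ?thesis using p[of j] \<open>w p = c\<close> by blast
    qed
    then obtain P Q where PQ: "w P = c" "w Q = c" "occ w a P n = Suc (occ w a Q n)" by blast
    have alt: "w (q + n) = a \<longleftrightarrow> w q \<noteq> a" if "w q \<noteq> c" for q
      using other_letters_alternate[OF bal \<open>n \<ge> 1\<close> letters const PQ that] .
    have "w (q + 2 * n) = w q" for q
    proof -
      have two: "q + 2 * n = q + n + n" by simp
      show ?thesis
        using alt[of q] alt[of "q + n"] shift[of q] shift[of "q + n"]
          in_letters[of q] in_letters[of "q + n + n"]
        unfolding two by (cases "w q = c") auto
    qed
    then show ?thesis unfolding ultimately_periodic_def using \<open>n \<ge> 1\<close>
      by (intro exI[of _ "2 * n"]) auto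
  qed
qed

lemma two_values_if_balanced_nonconstant:
  assumes bal: "balanced w" and nonconst: "\<And>K. \<not> (\<forall>i. occ w a i n = K)"
  obtains m i j where "\<And>k. occ w a k n = m \<or> occ w a k n = Suc m"
    and "occ w a i n = m" and "occ w a j n = Suc m"
proof -
  define m where "m = (LEAST m. \<exists>i. occ w a i n = m)"
  have "\<exists>i. occ w a i n = m" unfolding m_def by (rule LeastI_ex) blast
  then obtain i where i: "occ w a i n = m" by blast
  have "m \<le> occ w a k n" for k unfolding m_def by (rule Least_le) blast
  then have two_values: "occ w a k n = m \<or> occ w a k n = Suc m" for k
    using balanced_occ_le[OF bal, of a k n i] i by (metis Suc_eq_plus1 le_SucE le_antisym)
  moreover obtain j where "occ w a j n = Suc m" using nonconst[of m] two_values by blast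
  ultimately show thesis using i that by blast
qed

section \<open>Counting Abelian classes\<close>

text \<open>
  The equivalence relates all finite words, so a class contains more than factors of \<open>w\<close>: it is
  a full fibre of \<^const>\<open>count_list\<close>, and fibres correspond to values.
\<close>

lemma abelian_complexity_eq_card_range:
  "abelian_complexity w n = card (range (\<lambda>i a. occ w a i n))"
proof -
  let ?A = "{u \<in> factors w. length u = n}"
  let ?r = "{(u, v :: 'a list). abelian_equivalent u v}"
  let ?fibre = "\<lambda>\<phi> :: 'a \<Rightarrow> nat. count_list -` {\<phi>}"
  have factors_n: "?A = range (\<lambda>i. w [i \<rightarrow> i + n])"
    unfolding factors_def by (auto simp: subsequence_length)
  have "?r `` {u} = ?fibre (count_list u)" for u
    by (auto simp: abelian_equivalent_def fun_eq_iff)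
  then have "?A // ?r = ?fibre ` count_list ` ?A"
    by (auto simp: quotient_def)
  moreover have "inj_on ?fibre (count_list ` ?A)"
    by (rule inj_onI) blast
  moreover have "count_list ` ?A = range (\<lambda>i a. occ w a i n)"
    unfolding factors_n by (auto simp: occ_def image_image fun_eq_iff)
  ultimately show ?thesis
    unfolding abelian_complexity_def by (simp add: card_image)
qed

lemma abelian_complexity_three_letters:
  assumes "range w = {a, b, c}"
  shows "abelian_complexity w n = card (range (\<lambda>i. (occ w a i n, occ w b i n, occ w c i n)))"
proof -
  let ?parikh = "\<lambda>\<phi> :: 'a \<Rightarrow> nat. (\<phi> a, \<phi> b, \<phi> c)"
  have zero: "occ w x i n = 0" if "x \<notin> {a, b, c}" for x i
  proof (induction n)
    case (Suc n)
    have "w (i + n) \<noteq> x" using assms that by blast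
    then show ?case using Suc by (simp add: occ_Suc)
  qed simp
  have "inj_on ?parikh (range (\<lambda>i x. occ w x i n))"
  proof (rule inj_onI, clarsimp, rule ext)
    fix i j x
    assume "occ w a i n = occ w a j n" "occ w b i n = occ w b j n" "occ w c i n = occ w c j n"
    then show "occ w x i n = occ w x j n"
      using zero[of x i] zero[of x j] by (cases "x \<in> {a, b, c}") auto
  qed
  then show ?thesis
    unfolding abelian_complexity_eq_card_range
    by (simp add: card_image[symmetric] image_image)
qed

text \<open>
  After subtraction of the \<open>m\<close>'s the values are vectors in \<open>{0, 1}\<^sup>3\<close> of constant sum, with no
  constant coordinate: the three unit vectors or their complements.
\<close>

lemma card_two_valued_triples:
  fixes x y z :: "'i \<Rightarrow> nat"
  assumes sum: "\<And>i. x i + y i + z i = n"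
    and x: "\<And>i. x i = l \<or> x i = Suc l" "x i0 = l" "x i1 = Suc l"
    and y: "\<And>i. y i = m \<or> y i = Suc m" "y j0 = m" "y j1 = Suc m"
    and z: "\<And>i. z i = k \<or> z i = Suc k" "z k0 = k" "z k1 = Suc k"
  shows "card (range (\<lambda>i. (x i, y i, z i))) = 3"
proof -
  let ?t = "\<lambda>i. (x i, y i, z i)"
  have "n = Suc (l + m + k) \<or> n = Suc (Suc (l + m + k))"
    using sum[of i0] sum[of i1] x(2,3) y(1)[of i0] z(1)[of i0] y(1)[of i1] z(1)[of i1] by linarith
  then show ?thesis
  proof
    assume n: "n = Suc (l + m + k)"
    let ?S = "{(Suc l, m, k), (l, Suc m, k), (l, m, Suc k)}"
    have "?t i \<in> ?S" for i
      using sum[of i] n x(1)[of i] y(1)[of i] z(1)[of i] by auto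
    moreover have "?t i1 = (Suc l, m, k)"
      using sum[of i1] n x(3) y(1)[of i1] z(1)[of i1] by auto
    moreover have "?t j1 = (l, Suc m, k)"
      using sum[of j1] n y(3) x(1)[of j1] z(1)[of j1] by auto
    moreover have "?t k1 = (l, m, Suc k)"
      using sum[of k1] n z(3) x(1)[of k1] y(1)[of k1] by auto
    ultimately have "range ?t = ?S"
      by (intro equalityI) (blast, metis (no_types, lifting) empty_subsetI insert_subset rangeI)
    then show ?thesis by simp
  next
    assume n: "n = Suc (Suc (l + m + k))"
    let ?S = "{(l, Suc m, Suc k), (Suc l, m, Suc k), (Suc l, Suc m, k)}"
    have "?t i \<in> ?S" for i
      using sum[of i] n x(1)[of i] y(1)[of i] z(1)[of i] by auto
    moreover have "?t i0 = (l, Suc m, Suc k)"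
      using sum[of i0] n x(2) y(1)[of i0] z(1)[of i0] by auto
    moreover have "?t j0 = (Suc l, m, Suc k)"
      using sum[of j0] n y(2) x(1)[of j0] z(1)[of j0] by auto
    moreover have "?t k0 = (Suc l, Suc m, k)"
      using sum[of k0] n z(2) x(1)[of k0] y(1)[of k0] by auto
    ultimately have "range ?t = ?S"
      by (intro equalityI) (blast, metis (no_types, lifting) empty_subsetI insert_subset rangeI)
    then show ?thesis by simp
  qed
qed

theorem theorem6:
  fixes \<omega> :: "nat word"
  assumes "range \<omega> = {0, 1, 2}"
    and "aperiodic \<omega>"
    and "uniformly_recurrent \<omega>"
    and "balanced \<omega>"
  shows "\<forall>n\<ge>1. abelian_complexity \<omega> n = 3"
proof (intro allI impI)
  fix n :: nat
  assume "n \<ge> 1"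
  have nonconst: "\<not> (\<forall>i. occ \<omega> c i n = K)"
    if "range \<omega> = {a, b, c}" "a \<noteq> b" "a \<noteq> c" "b \<noteq> c" for a b c K
    using ultimately_periodic_if_constant_count[OF \<open>balanced \<omega>\<close> \<open>n \<ge> 1\<close> that] \<open>aperiodic \<omega>\<close>
    unfolding aperiodic_def by blast
  have "\<not> (\<forall>i. occ \<omega> 0 i n = K)" for K
    by (rule nonconst[of 1 2]) (use assms(1) in auto)
  then obtain l i0 i1 where x: "\<And>i. occ \<omega> 0 i n = l \<or> occ \<omega> 0 i n = Suc l"
      "occ \<omega> 0 i0 n = l" "occ \<omega> 0 i1 n = Suc l"
    using two_values_if_balanced_nonconstant[OF \<open>balanced \<omega>\<close>, of 0 n] by metis
  have "\<not> (\<forall>i. occ \<omega> 1 i n = K)" for K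
    by (rule nonconst[of 0 2]) (use assms(1) in auto)
  then obtain m j0 j1 where y: "\<And>i. occ \<omega> 1 i n = m \<or> occ \<omega> 1 i n = Suc m"
      "occ \<omega> 1 j0 n = m" "occ \<omega> 1 j1 n = Suc m"
    using two_values_if_balanced_nonconstant[OF \<open>balanced \<omega>\<close>, of 1 n] by metis
  have "\<not> (\<forall>i. occ \<omega> 2 i n = K)" for K
    by (rule nonconst[of 0 1]) (use assms(1) in auto)
  then obtain k k0 k1 where z: "\<And>i. occ \<omega> 2 i n = k \<or> occ \<omega> 2 i n = Suc k"
      "occ \<omega> 2 k0 n = k" "occ \<omega> 2 k1 n = Suc k"
    using two_values_if_balanced_nonconstant[OF \<open>balanced \<omega>\<close>, of 2 n] by metis
  have "occ \<omega> 0 i n + occ \<omega> 1 i n + occ \<omega> 2 i n = n" for i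
    by (rule occ_sum_three_letters[OF assms(1)]) auto
  from card_two_valued_triples[OF this x y z]
  show "abelian_complexity \<omega> n = 3"
    unfolding abelian_complexity_three_letters[OF assms(1)] .
qed

end
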